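(* Let $k\ge 0$. If $\gamma\in\mathcal{M}$ evolves by $Y_k$, that is, $\gamma_t\in\mathcal{M}$ with $\dot\gamma=Y_k(\gamma)$, then the generating loop $Y=\sum_{j\ge 0}Y_j\lambda^{-j}$ along $\gamma_t$ evolves by $V_k$, that is, $$\dot Y=V_k(Y)=Y\times(\lambda^{k+1}Y)_+ .$$
   Context: Let $M\cong\mathbb{R}$ be an oriented 1-manifold with a fixed translation $\tau\in\mathrm{Diff}(M)$, $M/\tau\cong S^1$. Let $h(p)=Ap+a$ ($A\in SO(3)$, $a\in\mathbb{R}^3$) be an orientation preserving Euclidean motion, and let $\mathcal{M}=\mathcal{M}_h$ be the manifold of smooth immersions $\gamma\colon M\to\mathbb{R}^3$ with $\gamma\circ\tau=h\circ\gamma$; $T_\gamma\mathcal{M}$ consists of smooth $\xi\colon M\to\mathbb{R}^3$ with $\xi\circ\tau=A\xi$. For $\gamma\in\mathcal{M}$ let $(\ )'$ denote the derivative with respect to the arclength of $\gamma$, and $T=\gamma'$. A dot denotes the derivative with respect to the evolution parameter $t$ (at fixed point of $M$). The vector fields $Y_k\in\Gamma(T\mathcal{M})$, $k\ge 0$, are defined by $Y_0=T$ and $Y_{k+1}=T\times Y_k'-\tfrac12\sum_{i=1}^{k}(Y_i,Y_{k-i+1})T$ for $k\ge0$. They satisfy $Y_k'+T\times Y_{k+1}=0$. $\Lambda\mathbb{R}^3=\mathbb{R}^3((\lambda^{-1}))$ is the loop Lie algebra of formal Laurent series in $\lambda^{-1}$ (finitely many positive powers of $\lambda$) with coefficients in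 $\mathbb{R}^3$, with $\times$ extended $\lambda$-bilinearly. It splits as $\Lambda^+\mathbb{R}^3\oplus\Lambda^-\mathbb{R}^3$, where $\Lambda^+\mathbb{R}^3$ consists of the polynomials in $\lambda$ without constant term and $\Lambda^-\mathbb{R}^3=\mathbb{R}^3[[\lambda^{-1}]]$. $(\ )_+$ is the projection onto $\Lambda^+\mathbb{R}^3$ along this splitting. The vector field $V_k$ on $\Lambda\mathbb{R}^3$ is $V_k(\xi)=\xi\times(\lambda^{k+1}\xi)_+$. *)

theory Defs
  imports "HOL-Analysis.Analysis" "HOL-Computational_Algebra.Formal_Laurent_Series"
begin

unbundle cross3_syntax

section \<open>Smooth maps on open sets\<close>

primrec higher_differentiable_on ::
  "nat \<Rightarrow> 'a::euclidean_space set \<Rightarrow> ('a \<Rightarrow> 'b::real_normed_vector) \<Rightarrow> bool" where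
  "higher_differentiable_on 0 S f \<longleftrightarrow> continuous_on S f"
| "higher_differentiable_on (Suc n) S f \<longleftrightarrow>
     (\<forall>x\<in>S. f differentiable (at x)) \<and>
     (\<forall>v. higher_differentiable_on n S (\<lambda>x. frechet_derivative f (at x) v))"

text \<open>For open \<open>S\<close> this is \<open>C\<^sup>\<infinity>\<close> on \<open>S\<close>; it is only used for open \<open>S\<close>.\<close>

definition smooth_on :: "'a::euclidean_space set \<Rightarrow> ('a \<Rightarrow> 'b::real_normed_vector) \<Rightarrow> bool" where
  "smooth_on S f \<longleftrightarrow> (\<forall>n. higher_differentiable_on n S f)"


section \<open>Curves with monodromy\<close>

text \<open>The oriented 1-manifold \<open>M\<close> is the real line with its standard orientation. Its coordinate
  is arbitrary, and accordingly \<open>\<tau>\<close> need not be \<open>x \<mapsto> x + c\<close> in it, but only in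
  some other global coordinate \<open>\<phi>\<close>.\<close>

definition diffeo :: "(real \<Rightarrow> real) \<Rightarrow> bool" where
  "diffeo \<phi> \<longleftrightarrow> bij \<phi> \<and> smooth_on UNIV \<phi> \<and> smooth_on UNIV (inv \<phi>)"

definition is_translation :: "(real \<Rightarrow> real) \<Rightarrow> bool" where
  "is_translation \<tau> \<longleftrightarrow> (\<exists>\<phi> c. diffeo \<phi> \<and> c \<noteq> 0 \<and> (\<forall>x. \<phi> (\<tau> x) = \<phi> x + c))"

definition orientation_preserving_motion :: "(real^3 \<Rightarrow> real^3) \<Rightarrow> bool" where
  "orientation_preserving_motion h \<longleftrightarrow>
     (\<exists>(A::real^3^3) a. rotation_matrix A \<and> h = (\<lambda>p. A *v p + a))"

definition immersion :: "(real \<Rightarrow> real^3) \<Rightarrow> bool" where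
  "immersion \<gamma> \<longleftrightarrow> smooth_on UNIV \<gamma> \<and> (\<forall>x. vector_derivative \<gamma> (at x) \<noteq> 0)"

definition curve_space :: "(real \<Rightarrow> real) \<Rightarrow> (real^3 \<Rightarrow> real^3) \<Rightarrow> (real \<Rightarrow> real^3) set" where
  "curve_space \<tau> h = {\<gamma>. immersion \<gamma> \<and> \<gamma> \<circ> \<tau> = h \<circ> \<gamma>}"

text \<open>The derivative of \<open>f\<close> with respect to the arclength of \<open>\<gamma>\<close>.\<close>

definition arc_deriv :: "(real \<Rightarrow> real^3) \<Rightarrow> (real \<Rightarrow> real^3) \<Rightarrow> real \<Rightarrow> real^3" where
  "arc_deriv \<gamma> f x = vector_derivative f (at x) /\<^sub>R norm (vector_derivative \<gamma> (at x))"

definition tangent :: "(real \<Rightarrow> real^3) \<Rightarrow> real \<Rightarrow> real^3" where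
  "tangent \<gamma> = arc_deriv \<gamma> \<gamma>"

fun Y :: "(real \<Rightarrow> real^3) \<Rightarrow> nat \<Rightarrow> real \<Rightarrow> real^3" where
  "Y \<gamma> 0 = tangent \<gamma>"
| "Y \<gamma> (Suc k) = (\<lambda>x. tangent \<gamma> x \<times> arc_deriv \<gamma> (Y \<gamma> k) x
       - ((1/2) * (\<Sum>i=1..k. Y \<gamma> i x \<bullet> Y \<gamma> (k - i + 1) x)) *\<^sub>R tangent \<gamma> x)"


section \<open>The loop algebra\<close>

text \<open>The formal variable of \<^typ>\<open>(real^3) fls\<close> is \<open>\<lambda>\<^sup>-\<^sup>1\<close>: the coefficient of
  \<open>\<lambda>\<^sup>m\<close> in \<open>\<xi>\<close> is \<open>\<xi> $$ (- m)\<close>, and multiplication by \<open>\<lambda>\<^sup>m\<close> is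
  \<^term>\<open>fls_shift m\<close>. The cross product is the Cauchy product; below the subdegree all
  coefficients vanish, so the sum ranges over all nonzero terms.\<close>

definition loop_cross :: "(real^3) fls \<Rightarrow> (real^3) fls \<Rightarrow> (real^3) fls" where
  "loop_cross \<xi> \<eta> = Abs_fls (\<lambda>n. \<Sum>i = fls_subdegree \<xi>..n - fls_subdegree \<eta>.
     fls_nth \<xi> i \<times> fls_nth \<eta> (n - i))"

lemma loop_cross_nth:
  "fls_nth (loop_cross \<xi> \<eta>) n =
     (\<Sum>i = fls_subdegree \<xi>..n - fls_subdegree \<eta>. fls_nth \<xi> i \<times> fls_nth \<eta> (n - i))"
  unfolding loop_cross_def
  by (rule nth_Abs_fls_lower_bound[of "fls_subdegree \<xi> + fls_subdegree \<eta>"]) auto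

text \<open>\<^term>\<open>fls_regpart\<close> collects the powers \<open>\<lambda>\<^sup>m\<close> with \<open>m \<le> 0\<close>.\<close>

definition loop_plus :: "(real^3) fls \<Rightarrow> (real^3) fls" where
  "loop_plus \<xi> = \<xi> - fps_to_fls (fls_regpart \<xi>)"

lemma loop_plus_nth: "fls_nth (loop_plus \<xi>) n = (if n < 0 then fls_nth \<xi> n else 0)"
  by (simp add: loop_plus_def)

definition V :: "nat \<Rightarrow> (real^3) fls \<Rightarrow> (real^3) fls" where
  "V k \<xi> = loop_cross \<xi> (loop_plus (fls_shift (int (k + 1)) \<xi>))"

definition generating_loop :: "(real \<Rightarrow> real^3) \<Rightarrow> real \<Rightarrow> (real^3) fls" where
  "generating_loop \<gamma> x = fps_to_fls (Abs_fps (\<lambda>j. Y \<gamma> j x))"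

definition has_loop_derivative ::
  "(real \<Rightarrow> (real^3) fls) \<Rightarrow> (real^3) fls \<Rightarrow> real \<Rightarrow> bool" where
  "has_loop_derivative F D t \<longleftrightarrow>
     (\<forall>n. ((\<lambda>s. fls_nth (F s) n) has_vector_derivative fls_nth D n) (at t))"

unbundle no cross3_syntax

end

theory Submission
  imports Defs
begin

text \<open>
  Write \<open>T = Y\<^sub>0\<close>, let a prime denote the derivative by arclength, and let
  \<open>Y = \<Sum>\<^sub>j Y\<^sub>j \<lambda>\<^sup>-\<^sup>j\<close>. Two identities characterise the generating loop. The tangential part
  of the recursion is chosen so that \<open>(Y, Y) = 1\<close> (\<open>convolution_y\<close>), and then the recursion is
  equivalent to \<open>Y' = \<lambda> Y \<times> T\<close> (\<open>ds_y\<close>), that is \<open>Y\<^sub>n' = Y\<^sub>n\<^sub>+\<^sub>1 \<times> T\<close>. In particular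
  \<open>Y\<^sub>k'\<close> is orthogonal to \<open>T\<close>, so the flow of \<open>Y\<^sub>k\<close> preserves arclength and the
  derivatives by time and by arclength commute (\<open>dt_ds_commute\<close>).

  The two identities determine each \<open>Y\<^sub>n\<^sub>+\<^sub>1\<close> from \<open>Y\<^sub>0, \<dots>, Y\<^sub>n\<close>: the second gives its normal
  part, the first its tangential part. Differentiating them in time therefore determines
  all \<open>dY\<^sub>n/dt\<close> from \<open>dT/dt = Y\<^sub>k' = Y\<^sub>k\<^sub>+\<^sub>1 \<times> T\<close>, and it remains to see that
  \<open>W = Y \<times> (\<lambda>\<^sup>k\<^sup>+\<^sup>1Y)\<^sub>+\<close> solves the linearised equations
  \<open>W' = \<lambda> (W \<times> T + Y \<times> W\<^sub>0)\<close> and \<open>(W, Y) = 0\<close> with \<open>W\<^sub>0 = Y\<^sub>k\<^sub>+\<^sub>1 \<times> T\<close>. The second equation is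
  obvious for series; the first follows from the Jacobi identity, and
  \<open>Y \<times> W\<^sub>0\<close> appears because the projection to the polynomial part does not commute with
  multiplication by \<open>\<lambda>\<close> (\<open>V_coeff_product_rule\<close>, \<open>V_coeff_orthogonal\<close>). Since the products of
  series of vectors are finite sums in each degree, all of this is done on coefficients.

  The analytic part of the argument is that every \<open>Y\<^sub>n\<close> is smooth jointly in time and the curve
  parameter, so that its mixed partial derivatives exist and commute
  (\<open>mixed_partials_commute\<close>).
\<close>

section \<open>Closure properties of smooth maps\<close>

lemma higher_differentiable_on_cong:
  assumes "open S" "\<And>x. x \<in> S \<Longrightarrow> f x = g x"
  shows "higher_differentiable_on n S f \<longleftrightarrow> higher_differentiable_on n S g"
  using assms(2)
proof (induction n arbitrary: f g)
  case 0
  then show ?case by (auto intro: continuous_on_eq)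
next
  case (Suc n)
  have deriv: "frechet_derivative f (at x) = frechet_derivative g (at x)"
    and diff: "f differentiable (at x) \<longleftrightarrow> g differentiable (at x)" if "x \<in> S" for x
  proof -
    have *: "(f has_derivative d) (at x) \<longleftrightarrow> (g has_derivative d) (at x)" for d
      using Suc.prems that assms(1) by (metis has_derivative_transform_within_open)
    show "frechet_derivative f (at x) = frechet_derivative g (at x)"
      unfolding frechet_derivative_def * ..
    show "f differentiable (at x) \<longleftrightarrow> g differentiable (at x)"
      unfolding differentiable_def * ..
  qed
  have "higher_differentiable_on n S (\<lambda>x. frechet_derivative f (at x) v) \<longleftrightarrow>
        higher_differentiable_on n S (\<lambda>x. frechet_derivative g (at x) v)" for v
    by (rule Suc.IH) (simp add: deriv)
  then show ?case using diff by auto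
qed

text \<open>The definition of order \<open>n + 1\<close> asks for differentiability and for order \<open>n\<close> of all
  directional derivatives; that this implies order \<open>n\<close> of the map itself is what lets the
  undifferentiated factors in the product rule enter the inductions below.\<close>

lemma higher_differentiable_on_SucD:
  "higher_differentiable_on (Suc n) S f \<Longrightarrow> higher_differentiable_on n S f"
proof (induction n arbitrary: f)
  case 0
  then show ?case
    by (auto intro!: continuous_at_imp_continuous_on differentiable_imp_continuous_within)
next
  case (Suc n)
  show ?case
    unfolding higher_differentiable_on.simps(2)[of n]
    using Suc.prems Suc.IH by (auto simp del: higher_differentiable_on.simps simp: higher_differentiable_on.simps(2)[of "Suc n"])
qed

text \<open>The recursion for \<open>higher_differentiable_on\<close> speaks of the derivative chosen by
  \<open>frechet_derivative\<close>; the product and chain rules supply explicit ones.\<close>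

lemma higher_differentiable_on_SucI:
  assumes "open S"
    and "\<And>x. x \<in> S \<Longrightarrow> (f has_derivative f' x) (at x)"
    and "\<And>v. higher_differentiable_on n S (\<lambda>x. f' x v)"
  shows "higher_differentiable_on (Suc n) S f"
proof -
  have "frechet_derivative f (at x) = f' x" if "x \<in> S" for x
    using assms(2)[OF that] by (rule frechet_derivative_at[symmetric])
  then have "higher_differentiable_on n S (\<lambda>x. frechet_derivative f (at x) v)" for v
    using higher_differentiable_on_cong[OF assms(1), of "\<lambda>x. frechet_derivative f (at x) v"
      "\<lambda>x. f' x v" n] assms(3) by simp
  then show ?thesis using assms(2) by (auto simp: differentiable_def)
qed

lemma higher_differentiable_on_const: "open S \<Longrightarrow> higher_differentiable_on n S (\<lambda>x. c)"
proof (induction n arbitrary: c)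
  case (Suc n)
  show ?case
    by (rule higher_differentiable_on_SucI[OF Suc.prems, where f' = "\<lambda>_ _. 0"])
      (auto intro: Suc)
qed simp

lemma higher_differentiable_on_derivative:
  assumes "higher_differentiable_on (Suc n) S f"
  shows "x \<in> S \<Longrightarrow> (f has_derivative frechet_derivative f (at x)) (at x)"
    and "higher_differentiable_on n S (\<lambda>x. frechet_derivative f (at x) v)"
  using assms by (auto simp: frechet_derivative_works)

lemma higher_differentiable_on_add:
  assumes "open S" "higher_differentiable_on n S f" "higher_differentiable_on n S g"
  shows "higher_differentiable_on n S (\<lambda>x. f x + g x)"
  using assms(2,3)
proof (induction n arbitrary: f g)
  case 0
  then show ?case by (auto intro: continuous_on_add)
next
  case (Suc n)
  note df = higher_differentiable_on_derivative[OF Suc.prems(1)]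
    and dg = higher_differentiable_on_derivative[OF Suc.prems(2)]
  show ?case
    by (rule higher_differentiable_on_SucI[OF assms(1)
          has_derivative_add[OF df(1) dg(1)] Suc.IH[OF df(2) dg(2)]])
qed

lemma higher_differentiable_on_bilinear:
  assumes "bounded_bilinear B" "open S"
    and "higher_differentiable_on n S f" "higher_differentiable_on n S g"
  shows "higher_differentiable_on n S (\<lambda>x. B (f x) (g x))"
  using assms(3,4)
proof (induction n arbitrary: f g)
  case 0
  then show ?case using bounded_bilinear.continuous_on[OF assms(1)] by auto
next
  case (Suc n)
  note df = higher_differentiable_on_derivative[OF Suc.prems(1)]
    and dg = higher_differentiable_on_derivative[OF Suc.prems(2)]
  show ?case
    by (rule higher_differentiable_on_SucI[OF assms(2)
          bounded_bilinear.FDERIV[OF assms(1) df(1) dg(1)]])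
      (auto intro!: higher_differentiable_on_add assms(2)
          Suc.IH df(2) dg(2) higher_differentiable_on_SucD[OF Suc.prems(1)]
          higher_differentiable_on_SucD[OF Suc.prems(2)])
qed

text \<open>All exponents are treated at once, since differentiating lowers the exponent by one.\<close>

lemma higher_differentiable_on_powr:
  fixes f :: "'a::euclidean_space \<Rightarrow> real"
  assumes "open S" "\<And>x. x \<in> S \<Longrightarrow> f x > 0"
    and "higher_differentiable_on n S f"
  shows "higher_differentiable_on n S (\<lambda>x. f x powr a)"
  using assms(3)
proof (induction n arbitrary: a)
  case 0
  then show ?case using assms(2) by (fastforce intro!: continuous_intros)
next
  case (Suc n)
  note df = higher_differentiable_on_derivative[OF Suc.prems]
  show ?case
  proof (rule higher_differentiable_on_SucI[OF assms(1)])
    show "((\<lambda>x. f x powr a) has_derivative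
        (\<lambda>v. (a * f x powr (a - 1)) * frechet_derivative f (at x) v)) (at x)" if "x \<in> S" for x
      using has_derivative_powr[OF df(1) has_derivative_const[of a], of x] that assms(2)[OF that]
      by (auto simp: powr_diff field_simps elim!: has_derivative_eq_rhs)
    show "higher_differentiable_on n S
        (\<lambda>x. (a * f x powr (a - 1)) * frechet_derivative f (at x) v)" for v
      by (intro higher_differentiable_on_bilinear[OF bounded_bilinear_mult assms(1)]
          higher_differentiable_on_const[OF assms(1)] Suc.IH df(2)
          higher_differentiable_on_SucD[OF Suc.prems])
  qed
qed

lemma smooth_on_derivative:
  assumes "smooth_on S f"
  shows "x \<in> S \<Longrightarrow> (f has_derivative frechet_derivative f (at x)) (at x)"
    and "smooth_on S (\<lambda>x. frechet_derivative f (at x) v)"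
proof -
  show "(f has_derivative frechet_derivative f (at x)) (at x)" if "x \<in> S"
    using higher_differentiable_on_derivative(1)[of 0 S f x] assms that
    unfolding smooth_on_def by blast
  show "smooth_on S (\<lambda>x. frechet_derivative f (at x) v)"
    using assms higher_differentiable_on_derivative(2) unfolding smooth_on_def by blast
qed

lemma smooth_on_imp_continuous_on: "smooth_on S f \<Longrightarrow> continuous_on S f"
  by (metis smooth_on_def higher_differentiable_on.simps(1))

lemma smooth_on_cong:
  "open S \<Longrightarrow> (\<And>x. x \<in> S \<Longrightarrow> f x = g x) \<Longrightarrow> smooth_on S f \<longleftrightarrow> smooth_on S g"
  using higher_differentiable_on_cong unfolding smooth_on_def by blast

lemma smooth_on_const: "open S \<Longrightarrow> smooth_on S (\<lambda>x. c)"
  by (simp add: smooth_on_def higher_differentiable_on_const)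

lemma smooth_on_bilinear:
  assumes "bounded_bilinear B" "open S" "smooth_on S f" "smooth_on S g"
  shows "smooth_on S (\<lambda>x. B (f x) (g x))"
  using assms higher_differentiable_on_bilinear unfolding smooth_on_def by blast

lemma smooth_on_add:
  "open S \<Longrightarrow> smooth_on S f \<Longrightarrow> smooth_on S g \<Longrightarrow> smooth_on S (\<lambda>x. f x + g x)"
  using higher_differentiable_on_add unfolding smooth_on_def by blast

lemma smooth_on_diff:
  assumes "open S" "smooth_on S f" "smooth_on S g"
  shows "smooth_on S (\<lambda>x. f x - g x)"
  using smooth_on_add[OF assms(1,2) smooth_on_bilinear[OF bounded_bilinear_scaleR assms(1)
    smooth_on_const[OF assms(1), of "-1"] assms(3)]] by simp

lemma smooth_on_sum:
  assumes "open S" "\<And>i. i \<in> A \<Longrightarrow> smooth_on S (f i)"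
  shows "smooth_on S (\<lambda>x. \<Sum>i\<in>A. f i x)"
  using assms(2)
  by (induction A rule: infinite_finite_induct)
    (auto intro!: smooth_on_add smooth_on_const assms(1))

lemma smooth_on_powr:
  fixes f :: "'a::euclidean_space \<Rightarrow> real"
  assumes "open S" "\<And>x. x \<in> S \<Longrightarrow> f x > 0" "smooth_on S f"
  shows "smooth_on S (\<lambda>x. f x powr a)"
  using assms higher_differentiable_on_powr unfolding smooth_on_def by blast

text \<open>The norm is not smooth at the origin. Away from it the inverse speed of a curve is a real power
  of a positive smooth function.\<close>

lemma inverse_norm_eq_powr:
  fixes v :: "'a::real_inner"
  shows "v \<noteq> 0 \<Longrightarrow> inverse (norm v) = (v \<bullet> v) powr (-1/2)"
  by (simp add: norm_eq_sqrt_inner powr_minus powr_half_sqrt)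

lemma smooth_on_inverse_norm:
  fixes f :: "'a::euclidean_space \<Rightarrow> 'b::real_inner"
  assumes "open S" "\<And>x. x \<in> S \<Longrightarrow> f x \<noteq> 0" "smooth_on S f"
  shows "smooth_on S (\<lambda>x. inverse (norm (f x)))"
proof -
  have "smooth_on S (\<lambda>x. (f x \<bullet> f x) powr (-1/2))"
    using assms by (intro smooth_on_powr smooth_on_bilinear[OF bounded_bilinear_inner]) auto
  then show ?thesis
    using smooth_on_cong[OF assms(1), of "\<lambda>x. inverse (norm (f x))"]
    by (simp add: inverse_norm_eq_powr assms(2))
qed

section \<open>Partial derivatives in two variables\<close>

definition dt :: "(real \<times> real \<Rightarrow> 'b::real_normed_vector) \<Rightarrow> real \<times> real \<Rightarrow> 'b" where
  "dt F p = frechet_derivative F (at p) (1, 0)"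

definition dx :: "(real \<times> real \<Rightarrow> 'b::real_normed_vector) \<Rightarrow> real \<times> real \<Rightarrow> 'b" where
  "dx F p = frechet_derivative F (at p) (0, 1)"

lemma smooth_on_dt: "smooth_on S F \<Longrightarrow> smooth_on S (dt F)"
  unfolding dt_def[abs_def] by (rule smooth_on_derivative)

lemma smooth_on_dx: "smooth_on S F \<Longrightarrow> smooth_on S (dx F)"
  unfolding dx_def[abs_def] by (rule smooth_on_derivative)

lemma has_vector_derivative_dt:
  assumes "smooth_on S F" "(t, x) \<in> S"
  shows "((\<lambda>s. F (s, x)) has_vector_derivative dt F (t, x)) (at t)"
proof -
  note D = smooth_on_derivative(1)[OF assms]
  have "((\<lambda>s. (s, x)) has_derivative (\<lambda>h. h *\<^sub>R (1, 0))) (at t)"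
    by (auto intro!: derivative_eq_intros)
  from has_derivative_compose[OF this D] show ?thesis
    unfolding has_vector_derivative_def dt_def
    by (simp only: linear_scale[OF has_derivative_linear[OF D]])
qed

lemma has_vector_derivative_dx:
  assumes "smooth_on S F" "(t, x) \<in> S"
  shows "((\<lambda>y. F (t, y)) has_vector_derivative dx F (t, x)) (at x)"
proof -
  note D = smooth_on_derivative(1)[OF assms]
  have "((\<lambda>y. (t, y)) has_derivative (\<lambda>h. h *\<^sub>R (0, 1))) (at x)"
    by (auto intro!: derivative_eq_intros)
  from has_derivative_compose[OF this D] show ?thesis
    unfolding has_vector_derivative_def dx_def
    by (simp only: linear_scale[OF has_derivative_linear[OF D]])
qed

lemma dt_cong:
  assumes "open S" "p \<in> S" "\<And>q. q \<in> S \<Longrightarrow> F q = G q"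
  shows "dt F p = dt G p"
proof -
  have "(F has_derivative d) (at p) \<longleftrightarrow> (G has_derivative d) (at p)" for d
    using assms by (metis has_derivative_transform_within_open)
  then show ?thesis unfolding dt_def frechet_derivative_def by simp
qed

lemma dx_cong:
  assumes "open S" "p \<in> S" "\<And>q. q \<in> S \<Longrightarrow> F q = G q"
  shows "dx F p = dx G p"
proof -
  have "(F has_derivative d) (at p) \<longleftrightarrow> (G has_derivative d) (at p)" for d
    using assms by (metis has_derivative_transform_within_open)
  then show ?thesis unfolding dx_def frechet_derivative_def by simp
qed

lemma dt_bilinear:
  assumes "bounded_bilinear B" "smooth_on S F" "smooth_on S G" "p \<in> S"
  shows "dt (\<lambda>q. B (F q) (G q)) p = B (F p) (dt G p) + B (dt F p) (G p)"
  unfolding dt_def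
  by (subst frechet_derivative_at[symmetric, OF bounded_bilinear.FDERIV[OF assms(1)
        smooth_on_derivative(1)[OF assms(2,4)] smooth_on_derivative(1)[OF assms(3,4)]]]) simp

lemma dx_bilinear:
  assumes "bounded_bilinear B" "smooth_on S F" "smooth_on S G" "p \<in> S"
  shows "dx (\<lambda>q. B (F q) (G q)) p = B (F p) (dx G p) + B (dx F p) (G p)"
  unfolding dx_def
  by (subst frechet_derivative_at[symmetric, OF bounded_bilinear.FDERIV[OF assms(1)
        smooth_on_derivative(1)[OF assms(2,4)] smooth_on_derivative(1)[OF assms(3,4)]]]) simp

lemma dt_sum:
  assumes "\<And>i. i \<in> A \<Longrightarrow> smooth_on S (F i)" "p \<in> S"
  shows "dt (\<lambda>q. \<Sum>i\<in>A. F i q) p = (\<Sum>i\<in>A. dt (F i) p)"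
  unfolding dt_def
  by (subst frechet_derivative_at[symmetric, OF has_derivative_sum[OF
        smooth_on_derivative(1)[OF assms]]]) simp_all

lemma dx_sum:
  assumes "\<And>i. i \<in> A \<Longrightarrow> smooth_on S (F i)" "p \<in> S"
  shows "dx (\<lambda>q. \<Sum>i\<in>A. F i q) p = (\<Sum>i\<in>A. dx (F i) p)"
  unfolding dx_def
  by (subst frechet_derivative_at[symmetric, OF has_derivative_sum[OF
        smooth_on_derivative(1)[OF assms]]]) simp_all

text \<open>The difference \<open>F (t, y) - F (t, a)\<close> is the integral of \<open>dx F (t, z)\<close> over
  \<open>z \<in> {a..y}\<close>. Differentiating under the
  integral sign in \<open>t\<close> needs only continuity of \<open>dt (dx F)\<close>, and differentiating the result in
  \<open>y\<close> by the fundamental theorem of calculus gives \<open>dx (dt F) = dt (dx F)\<close>.\<close>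

lemma mixed_partials_commute:
  fixes F :: "real \<times> real \<Rightarrow> 'b::banach"
  assumes "open S" "smooth_on S F" "p \<in> S"
  shows "dt (dx F) p = dx (dt F) p"
proof -
  obtain t x where p: "p = (t, x)" by (cases p)
  obtain U W where UW: "open U" "open W" "t \<in> U" "x \<in> W" "U \<times> W \<subseteq> S"
    using open_prod_elim[OF assms(1,3)] p by (metis mem_Sigma_iff)
  obtain e where e: "e > 0" "cball t e \<subseteq> U" using UW open_contains_cball by metis
  obtain d where d: "d > 0" "cball x d \<subseteq> W" using UW open_contains_cball by metis
  define J where "J = {t - e <..< t + e}"
  define a b where "a = x - d" and "b = x + d"
  have sub: "(s, y) \<in> S" if "s \<in> J" "y \<in> {a..b}" for s y
  proof -
    have "s \<in> cball t e" "y \<in> cball x d"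
      using that by (auto simp: J_def a_def b_def dist_real_def)
    then show ?thesis using e d UW by blast
  qed
  note smF = smooth_on_dt[OF assms(2)] smooth_on_dx[OF assms(2)] smooth_on_dt[OF smooth_on_dx[OF assms(2)]]
  have tJ: "t \<in> J" and J: "open J" "convex J" using e by (auto simp: J_def)
  have cont: "continuous_on (J \<times> {a..b}) (dt (dx F))"
    by (rule continuous_on_subset[OF smooth_on_imp_continuous_on[OF smF(3)]])
      (auto intro: sub)
  have cont': "continuous_on {a..b} (\<lambda>y. dt (dx F) (t, y))"
    by (rule continuous_on_compose2[OF smooth_on_imp_continuous_on[OF smF(3)]])
      (auto intro!: continuous_intros sub tJ)
  have ftc: "((\<lambda>y. dx F (s, y)) has_integral (F (s, y) - F (s, a))) {a..y}"
    if "s \<in> J" "y \<in> {a..b}" for s y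
    using that
    by (intro fundamental_theorem_of_calculus)
      (auto intro!: has_vector_derivative_at_within has_vector_derivative_dx[OF assms(2)] sub)
  have dtF: "dt F (t, y) = dt F (t, a) + integral {a..y} (\<lambda>z. dt (dx F) (t, z))"
    if y: "y \<in> {a..b}" for y
  proof -
    have "((\<lambda>s. integral {a..y} (\<lambda>z. dx F (s, z))) has_vector_derivative
        integral {a..y} (\<lambda>z. dt (dx F) (t, z))) (at t within J)"
      using y tJ J unfolding cbox_interval[symmetric]
      by (intro leibniz_rule_vector_derivative[where fx = "\<lambda>s z. dt (dx F) (s, z)"])
        (auto intro!: has_vector_derivative_at_within has_vector_derivative_dt[OF smF(2)] sub
          has_integral_integrable[OF ftc] continuous_on_subset[OF cont])
    then have "((\<lambda>s. F (s, y) - F (s, a)) has_vector_derivative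
        integral {a..y} (\<lambda>z. dt (dx F) (t, z))) (at t within J)"
      by (rule has_vector_derivative_transform[OF tJ, rotated])
        (rule integral_unique[OF ftc, OF _ y, symmetric])
    then have "((\<lambda>s. F (s, y) - F (s, a)) has_vector_derivative
        integral {a..y} (\<lambda>z. dt (dx F) (t, z))) (at t)"
      using at_within_open[OF tJ J(1)] by simp
    moreover have "((\<lambda>s. F (s, y) - F (s, a)) has_vector_derivative
        dt F (t, y) - dt F (t, a)) (at t)"
      using y d by (intro has_vector_derivative_diff has_vector_derivative_dt[OF assms(2)] sub tJ)
        (auto simp: a_def b_def)
    ultimately show ?thesis
      using vector_derivative_unique_at by fastforce
  qed
  have x: "x \<in> {a<..<b}" using d by (auto simp: a_def b_def)
  have "((\<lambda>y. dt F (t, a) + integral {a..y} (\<lambda>z. dt (dx F) (t, z))) has_vector_derivative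
      0 + dt (dx F) (t, x)) (at x within {a..b})"
    using x by (intro has_vector_derivative_add has_vector_derivative_const
        integral_has_vector_derivative[OF cont']) auto
  then have "((\<lambda>y. dt F (t, y)) has_vector_derivative 0 + dt (dx F) (t, x)) (at x within {a..b})"
    by (rule has_vector_derivative_transform[rotated 2]) (use x in simp, rule dtF)
  then have "((\<lambda>y. dt F (t, y)) has_vector_derivative dt (dx F) (t, x)) (at x)"
    using x by (simp add: at_within_Icc_at)
  moreover have "((\<lambda>y. dt F (t, y)) has_vector_derivative dx (dt F) (t, x)) (at x)"
    using assms(3) p by (intro has_vector_derivative_dx[OF smF(1)]) simp
  ultimately show ?thesis
    using vector_derivative_unique_at p by blast
qed

section \<open>The algebra of the flow\<close>

unbundle cross3_syntax

text \<open>Every cancellation below is of this kind: a cross product or a triple product of two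
  coefficients of the same series, summed over a symmetric range of indices.\<close>

lemma sum_antisymmetric_eq_0:
  fixes g :: "nat \<Rightarrow> 'a::real_vector"
  assumes "\<And>i. i \<le> n \<Longrightarrow> g (n - i) = - g i"
  shows "(\<Sum>i\<le>n. g i) = 0"
proof -
  have "(\<Sum>i\<le>n. g i) = (\<Sum>i\<le>n. g (n - i))"
    by (rule sum.nat_diff_reindex[of g "Suc n", simplified lessThan_Suc_atMost diff_Suc_Suc, symmetric])
  also have "\<dots> = - (\<Sum>i\<le>n. g i)"
    by (simp add: assms sum_negf)
  finally have "2 *\<^sub>R (\<Sum>i\<le>n. g i) = 0"
    by (simp add: scaleR_2 eq_neg_iff_add_eq_0)
  then show ?thesis by simp
qed

lemma sum_product_rule_convolution:
  fixes y y' :: "nat \<Rightarrow> 'a::real_inner"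
  shows "(\<Sum>i\<le>n. y i \<bullet> y' (n - i) + y' i \<bullet> y (n - i)) = 2 * (\<Sum>i\<le>n. y' i \<bullet> y (n - i))"
proof -
  have "(\<Sum>i\<le>n. y i \<bullet> y' (n - i)) = (\<Sum>i\<le>n. y' i \<bullet> y (n - i))"
    by (rule sum.reindex_bij_witness[of _ "\<lambda>i. n - i" "\<lambda>i. n - i"]) (auto simp: inner_commute)
  then show ?thesis by (simp add: sum.distrib)
qed

lemma cross_triple_swap: "(z \<times> y) \<bullet> x = - ((x \<times> y) \<bullet> z)" for x y z :: "real^3"
  by (simp add: cross3_simps)

text \<open>The Jacobi identity: \<open>\<lambda>v. v \<times> z\<close> is a derivation of the cross product.\<close>

lemma cross_cross_derivation:
  "(x \<times> y) \<times> z = (x \<times> z) \<times> y + x \<times> (y \<times> z)" for x y z :: "real^3"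
  by (simp add: cross3_simps)

lemma cross_cross_left: "(x \<times> y) \<times> z = (x \<bullet> z) *\<^sub>R y - (y \<bullet> z) *\<^sub>R x" for x y z :: "real^3"
  by (simp add: cross3_simps forall_3)

lemma sum_cross_left: "(\<Sum>i\<in>A. f i) \<times> v = (\<Sum>i\<in>A. f i \<times> v)" for v :: "real^3"
  by (induction A rule: infinite_finite_induct) (auto simp: cross_add_left)

lemma eq_if_cross_and_inner_eq:
  fixes a b u :: "real^3"
  assumes "a \<times> u = b \<times> u" "a \<bullet> u = b \<bullet> u" "u \<bullet> u = 1"
  shows "a = b"
proof -
  have "v = (v \<bullet> u) *\<^sub>R u - (v \<times> u) \<times> u" for v
    using assms(3) by (simp add: cross_cross_left inner_commute)
  then show ?thesis using assms(1,2) by metis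
qed

text \<open>This is the coefficient of \<open>\<lambda>\<^sup>-\<^sup>n\<close> in
  \<open>\<eta> \<times> (\<lambda>\<^sup>k\<^sup>+\<^sup>1\<eta>)\<^sub>+\<close> for the series \<open>\<eta> = \<Sum>\<^sub>j y\<^sub>j \<lambda>\<^sup>-\<^sup>j\<close>: the polynomial
  factor contains exactly \<open>y\<^sub>0, \<dots>, y\<^sub>k\<close>, and \<open>y\<^sub>i\<close> there carries the power
  \<open>\<lambda>\<^sup>k\<^sup>+\<^sup>1\<^sup>-\<^sup>i\<close>.\<close>

definition V_coeff :: "nat \<Rightarrow> (nat \<Rightarrow> real^3) \<Rightarrow> nat \<Rightarrow> real^3" where
  "V_coeff k y n = (\<Sum>i\<le>k. y (n + k + 1 - i) \<times> y i)"

lemma full_cross_sum_eq_0: "(\<Sum>i\<le>n. y (n - i) \<times> y i) = 0" for y :: "nat \<Rightarrow> real^3"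
  by (rule sum_antisymmetric_eq_0) (simp, rule cross_skew)

text \<open>The full antisymmetric sum over \<open>i \<le> k + 1\<close> vanishes, so the sum over \<open>i \<le> k\<close> is minus
  its last term.\<close>

lemma V_coeff_0: "V_coeff k y 0 = y (k + 1) \<times> y 0"
proof -
  have "(\<Sum>i\<le>Suc k. y (Suc k - i) \<times> y i) = 0" by (rule full_cross_sum_eq_0)
  then have "V_coeff k y 0 = - (y 0 \<times> y (Suc k))"
    by (simp add: V_coeff_def eq_neg_iff_add_eq_0)
  then show ?thesis using cross_skew[of "y 0" "y (Suc k)"] by simp
qed

text \<open>If \<open>\<eta>\<close> obeys the equation \<open>\<eta>' = \<lambda> \<eta> \<times> y\<^sub>0\<close>, then \<open>U = (\<lambda>\<^sup>k\<^sup>+\<^sup>1\<eta>)\<^sub>+\<close> obeys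
  \<open>U' = \<lambda> (U \<times> y\<^sub>0 + y\<^sub>k\<^sub>+\<^sub>1 \<times> y\<^sub>0)\<close>, where the last term is the one that the projection cuts
  off. With the derivation property of \<open>\<times> y\<^sub>0\<close> this gives
  \<open>(\<eta> \<times> U)' = \<lambda> ((\<eta> \<times> U) \<times> y\<^sub>0 + \<eta> \<times> (y\<^sub>k\<^sub>+\<^sub>1 \<times> y\<^sub>0))\<close>, whose coefficients are compared
  here: the left-hand side is the derivative of \<open>V_coeff k y n\<close> by the product rule, and
  \<open>V_coeff k y 0 = y\<^sub>k\<^sub>+\<^sub>1 \<times> y\<^sub>0\<close>.\<close>

lemma V_coeff_product_rule:
  assumes "\<And>i. y' i = y (Suc i) \<times> y 0"
  shows "(\<Sum>i\<le>k. y (n + k + 1 - i) \<times> y' i + y' (n + k + 1 - i) \<times> y i) =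
    V_coeff k y (Suc n) \<times> y 0 + y (Suc n) \<times> V_coeff k y 0"
proof -
  define c where "c i = y (n + k + 2 - i) \<times> (y i \<times> y 0)" for i
  have "V_coeff k y (Suc n) \<times> y 0
      = (\<Sum>i\<le>k. (y (n + k + 2 - i) \<times> y 0) \<times> y i + c i)"
    unfolding V_coeff_def sum_cross_left c_def
    by (rule sum.cong) (auto simp: cross_cross_derivation[of _ "y _" "y 0"])
  also have "\<dots> = (\<Sum>i\<le>k. y' (n + k + 1 - i) \<times> y i) + (\<Sum>i\<le>k. c i)"
    by (simp add: sum.distrib assms Suc_diff_le)
  \<comment> \<open>Shifting the index drops \<open>c 0 = 0\<close> and adds the term at \<open>k + 1\<close>, the one that the
    projection cuts off.\<close>
  also have "(\<Sum>i\<le>k. c i) = (\<Sum>i\<le>k. c (Suc i)) - y (Suc n) \<times> V_coeff k y 0"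
  proof -
    have "(\<Sum>i\<le>k. c i) + c (Suc k) = c 0 + (\<Sum>i\<le>k. c (Suc i))"
      using sum.atMost_Suc[of c k] sum.atMost_Suc_shift[of c k] by simp
    then show ?thesis by (simp add: c_def V_coeff_0 algebra_simps)
  qed
  also have "(\<Sum>i\<le>k. c (Suc i)) = (\<Sum>i\<le>k. y (n + k + 1 - i) \<times> y' i)"
    by (simp add: c_def assms)
  finally show ?thesis by (simp add: sum.distrib)
qed

text \<open>The coefficients of \<open>(\<eta> \<times> U, \<eta>) = 0\<close>, with \<open>U = (\<lambda>\<^sup>k\<^sup>+\<^sup>1\<eta>)\<^sub>+\<close>. For a fixed coefficient
  \<open>y\<^sub>i\<close> of \<open>U\<close> the triple products cancel in pairs only if the other two indices run over all
  natural numbers with a given sum. This includes coefficients of \<open>\<eta> \<times> U\<close> at positive powers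
  of \<open>\<lambda>\<close>, which the left-hand side omits; they vanish by \<open>full_cross_sum_eq_0\<close>.\<close>

lemma V_coeff_orthogonal: "(\<Sum>n\<le>m. V_coeff k y n \<bullet> y (m - n)) = 0"
proof -
  define N where "N = m + k + 1"
  \<comment> \<open>\<open>p = n + k + 1\<close> is the sum of the two indices in the cross product; \<open>p \<le> k\<close> are the
    coefficients at positive powers of \<open>\<lambda>\<close>.\<close>
  define f where "f p i = (y (p - i) \<times> y i) \<bullet> y (N - p)" for p i
  have low: "(\<Sum>i\<le>p. f p i) = 0" for p
    using full_cross_sum_eq_0[of y p] by (simp add: f_def flip: inner_sum_left)
  have col: "(\<Sum>p=i..N. f p i) = 0" if "i \<le> k" for i
  proof -
    have "(\<Sum>p=i..N. f p i) = (\<Sum>q\<le>N - i. f (q + i) i)"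
      using that sum.shift_bounds_cl_nat_ivl[of "\<lambda>p. f p i" 0 i "N - i"]
      by (simp add: N_def atMost_atLeast0)
    also have "\<dots> = 0"
    proof (rule sum_antisymmetric_eq_0)
      fix q assume "q \<le> N - i"
      with that have "N - i - q + i = N - q" "N - (N - q) = q" "N - q - i = N - (q + i)"
        by (auto simp: N_def)
      then show "f (N - i - q + i) i = - f (q + i) i"
        unfolding f_def using cross_triple_swap[of "y (N - (q + i))" "y i" "y q"] by simp
    qed
    finally show ?thesis .
  qed
  have "(\<Sum>n\<le>m. V_coeff k y n \<bullet> y (m - n)) = (\<Sum>n\<le>m. \<Sum>i\<le>k. f (n + (k + 1)) i)"
    by (simp add: V_coeff_def inner_sum_left f_def N_def)
  also have "\<dots> = (\<Sum>p=k+1..N. \<Sum>i\<le>k. f p i)"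
    using sum.shift_bounds_cl_nat_ivl[of "\<lambda>p. \<Sum>i\<le>k. f p i" 0 "k + 1" m]
    by (simp add: N_def atMost_atLeast0)
  also have "\<dots> = (\<Sum>p\<le>k. \<Sum>i\<le>p. f p i) + (\<Sum>p=k+1..N. \<Sum>i\<le>k. f p i)"
    by (simp add: low)
  also have "(\<Sum>p\<le>k. \<Sum>i\<le>p. f p i) = (\<Sum>i\<le>k. \<Sum>p=i..k. f p i)"
    using sum.swap_restrict[of "{..k}" "{..k}" f "\<lambda>p i. i \<le> p"]
    by (simp add: Collect_conj_eq[symmetric] atMost_def atLeastAtMost_def atLeast_def
        conj_commute Int_def cong: conj_cong)
  also have "(\<Sum>p=k+1..N. \<Sum>i\<le>k. f p i) = (\<Sum>i\<le>k. \<Sum>p=k+1..N. f p i)"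
    by (rule sum.swap)
  also have "(\<Sum>i\<le>k. \<Sum>p=i..k. f p i) + (\<Sum>i\<le>k. \<Sum>p=k+1..N. f p i)
      = (\<Sum>i\<le>k. \<Sum>p=i..N. f p i)"
    unfolding sum.distrib[symmetric]
  proof (rule sum.cong)
    show "(\<Sum>p=i..k. f p i) + (\<Sum>p=k+1..N. f p i) = (\<Sum>p=i..N. f p i)" if "i \<in> {..k}" for i
      using that sum.ub_add_nat[of i k "\<lambda>p. f p i" "N - k"]
      by (simp add: N_def add.commute[of k])
  qed simp
  also have "\<dots> = 0" by (simp add: col)
  finally show ?thesis .
qed

section \<open>The generating loop of immersed curves\<close>

lemma bounded_bilinear_cross3: "bounded_bilinear (\<times>)"
  using bilinear_cross bilinear_conv_bounded_bilinear by blast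

text \<open>Everything about single curves is formulated for a family smooth in both variables, because its
  consequences have to be differentiated in the parameter of the family.\<close>

locale immersed_curves =
  fixes I :: "real set" and \<gamma> :: "real \<Rightarrow> real \<Rightarrow> real^3"
  assumes open_I: "open I"
    and smooth: "smooth_on (SIGMA t:I. UNIV) (\<lambda>(t, x). \<gamma> t x)"
    and immersed: "\<And>t x. t \<in> I \<Longrightarrow> vector_derivative (\<gamma> t) (at x) \<noteq> 0"
begin

abbreviation S :: "(real \<times> real) set" where "S \<equiv> SIGMA t:I. UNIV"

abbreviation \<Gamma> :: "real \<times> real \<Rightarrow> real^3" where "\<Gamma> \<equiv> \<lambda>(t, x). \<gamma> t x"

definition y :: "nat \<Rightarrow> real \<times> real \<Rightarrow> real^3" where
  "y n = (\<lambda>(t, x). Y (\<gamma> t) n x)"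

text \<open>The derivative by arclength as an operator on functions of both variables, so that it can be
  iterated and compared with \<open>dt\<close>.\<close>

definition ds :: "(real \<times> real \<Rightarrow> 'b::real_normed_vector) \<Rightarrow> real \<times> real \<Rightarrow> 'b" where
  "ds F p = inverse (norm (dx \<Gamma> p)) *\<^sub>R dx F p"

lemma open_S: "open S"
  by (simp add: open_I open_Times)

lemma dx_curve:
  assumes "p \<in> S"
  shows "dx \<Gamma> p = vector_derivative (\<gamma> (fst p)) (at (snd p))" and "dx \<Gamma> p \<noteq> 0"
proof -
  show "dx \<Gamma> p = vector_derivative (\<gamma> (fst p)) (at (snd p))"
    using has_vector_derivative_dx[OF smooth, of "fst p" "snd p"] assms
    by (auto intro: vector_derivative_at[symmetric])
  then show "dx \<Gamma> p \<noteq> 0" using immersed assms by auto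
qed

lemma arc_deriv_eq_ds:
  assumes "smooth_on S F" "(t, x) \<in> S"
  shows "arc_deriv (\<gamma> t) (\<lambda>z. F (t, z)) x = ds F (t, x)"
  using vector_derivative_at[OF has_vector_derivative_dx[OF assms]] dx_curve(1)[OF assms(2)]
  by (simp add: arc_deriv_def ds_def)

lemma smooth_on_inverse_speed: "smooth_on S (\<lambda>p. inverse (norm (dx \<Gamma> p)))"
  by (intro smooth_on_inverse_norm open_S dx_curve(2) smooth_on_dx smooth)

lemma smooth_on_ds: "smooth_on S F \<Longrightarrow> smooth_on S (ds F)"
  unfolding ds_def[abs_def]
  by (intro smooth_on_bilinear[OF bounded_bilinear_scaleR open_S]
      smooth_on_inverse_speed smooth_on_dx)

lemma ds_bilinear:
  assumes "bounded_bilinear B" "smooth_on S F" "smooth_on S G" "p \<in> S"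
  shows "ds (\<lambda>q. B (F q) (G q)) p = B (F p) (ds G p) + B (ds F p) (G p)"
  using bounded_bilinear.scaleR_left[OF assms(1)] bounded_bilinear.scaleR_right[OF assms(1)]
  by (simp add: ds_def dx_bilinear[OF assms] scaleR_add_right)

lemma ds_sum:
  assumes "\<And>i. i \<in> A \<Longrightarrow> smooth_on S (F i)" "p \<in> S"
  shows "ds (\<lambda>q. \<Sum>i\<in>A. F i q) p = (\<Sum>i\<in>A. ds (F i) p)"
  by (simp add: ds_def dx_sum[OF assms] scaleR_sum_right)

lemma ds_cong: "p \<in> S \<Longrightarrow> (\<And>q. q \<in> S \<Longrightarrow> F q = G q) \<Longrightarrow> ds F p = ds G p"
  unfolding ds_def using dx_cong[OF open_S] by metis

lemma y_0: "p \<in> S \<Longrightarrow> y 0 p = ds \<Gamma> p"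
  using arc_deriv_eq_ds[OF smooth] by (cases p) (simp add: y_def tangent_def)

lemma y_Suc:
  assumes "smooth_on S (y n)" "p \<in> S"
  shows "y (Suc n) p =
    y 0 p \<times> ds (y n) p - ((1/2) * (\<Sum>i=1..n. y i p \<bullet> y (n - i + 1) p)) *\<^sub>R y 0 p"
proof -
  obtain t x where p: "p = (t, x)" by (cases p)
  have "arc_deriv (\<gamma> t) (Y (\<gamma> t) n) x = ds (y n) p"
    using arc_deriv_eq_ds[OF assms(1)] assms(2) by (simp add: p y_def del: Y.simps)
  then show ?thesis
    unfolding y_def p prod.case Y.simps(2) by (simp only: Y.simps(1))
qed

lemma smooth_on_y: "smooth_on S (y n)"
proof (induction n rule: less_induct)
  case (less n)
  show ?case
  proof (cases n)
    case 0
    then show ?thesis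
      using smooth_on_cong[OF open_S y_0] smooth_on_ds[OF smooth] by simp
  next
    case (Suc m)
    have "smooth_on S (\<lambda>p. y 0 p \<times> ds (y m) p
        - ((1/2) * (\<Sum>i=1..m. y i p \<bullet> y (m - i + 1) p)) *\<^sub>R y 0 p)"
      using Suc
      by (intro smooth_on_diff smooth_on_sum open_S smooth_on_ds less.IH smooth_on_const
          smooth_on_bilinear[OF bounded_bilinear_cross3] smooth_on_bilinear[OF bounded_bilinear_scaleR]
          smooth_on_bilinear[OF bounded_bilinear_inner] smooth_on_bilinear[OF bounded_bilinear_mult]) auto
    then show ?thesis
      using smooth_on_cong[OF open_S y_Suc[OF less.IH[of m]]] Suc by simp
  qed
qed

lemma y_0_unit: "p \<in> S \<Longrightarrow> y 0 p \<bullet> y 0 p = 1"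
  using dx_curve(2)[of p] by (simp add: y_0 ds_def dot_square_norm power2_eq_square)

text \<open>The coefficients of \<open>(Y, Y) = 1\<close>. The tangential part in the recursion is chosen precisely to
  make them vanish.\<close>

lemma convolution_y:
  assumes "p \<in> S"
  shows "(\<Sum>i\<le>n. y i p \<bullet> y (n - i) p) = (if n = 0 then 1 else 0)"
proof (cases n)
  case 0
  then show ?thesis using y_0_unit[OF assms] by simp
next
  case (Suc m)
  let ?\<sigma> = "\<Sum>i=1..m. y i p \<bullet> y (m - i + 1) p"
  have mid: "(\<Sum>i=1..m. y i p \<bullet> y (Suc m - i) p) = ?\<sigma>"
    by (rule sum.cong) (auto simp: Suc_diff_le)
  have "{..Suc m} = insert 0 (insert (Suc m) {1..m})" by auto
  then have "(\<Sum>i\<le>Suc m. y i p \<bullet> y (Suc m - i) p) = ?\<sigma> + 2 * (y (Suc m) p \<bullet> y 0 p)"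
    by (simp add: mid[simplified] inner_commute)
  moreover have "y (Suc m) p \<bullet> y 0 p = - (1/2) * ?\<sigma>"
    unfolding y_Suc[OF smooth_on_y assms]
    by (simp add: inner_diff_left dot_cross_self y_0_unit[OF assms])
  ultimately show ?thesis using Suc by simp
qed

lemma smooth_on_convolution: "smooth_on S (\<lambda>q. y i q \<bullet> y j q)"
  by (rule smooth_on_bilinear[OF bounded_bilinear_inner open_S smooth_on_y smooth_on_y])

text \<open>In the recursion \<open>ds (y n)\<close> enters through \<open>y 0 \<times> ds (y n)\<close>, which determines its normal part;
  hence the claim is that \<open>ds (y n)\<close> is orthogonal to the tangent. Differentiating the coefficient
  \<open>n\<close> of \<open>(Y, Y) = 1\<close> expresses the tangential part through \<open>ds (y i)\<close> with \<open>i < n\<close>; by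
  induction these are \<open>y (i + 1) \<times> y 0\<close>, and the resulting triple products cancel in pairs.\<close>

lemma ds_y: "p \<in> S \<Longrightarrow> ds (y n) p = y (Suc n) p \<times> y 0 p"
proof (induction n rule: less_induct)
  case (less n)
  have "0 = ds (\<lambda>q. \<Sum>i\<le>n. y i q \<bullet> y (n - i) q) p"
    using ds_cong[OF less.prems convolution_y[of _ n]] by (simp add: ds_def dx_def)
  also have "\<dots> = (\<Sum>i\<le>n. y i p \<bullet> ds (y (n - i)) p + ds (y i) p \<bullet> y (n - i) p)"
    by (simp add: ds_sum smooth_on_convolution less.prems
        ds_bilinear[OF bounded_bilinear_inner smooth_on_y smooth_on_y])
  also have "\<dots> = 2 * (\<Sum>i\<le>n. ds (y i) p \<bullet> y (n - i) p)"
    by (rule sum_product_rule_convolution)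
  finally have "(\<Sum>i<n. ds (y i) p \<bullet> y (n - i) p) + ds (y n) p \<bullet> y 0 p = 0"
    by (simp flip: lessThan_Suc_atMost)
  moreover have "(\<Sum>i<n. ds (y i) p \<bullet> y (n - i) p) = 0"
  proof (cases n)
    case (Suc m)
    have "(\<Sum>i<n. ds (y i) p \<bullet> y (n - i) p)
        = (\<Sum>i\<le>m. (y (Suc i) p \<times> y 0 p) \<bullet> y (Suc (m - i)) p)"
      using less Suc by (auto simp: lessThan_Suc_atMost Suc_diff_le intro!: sum.cong)
    also have "\<dots> = 0"
      by (rule sum_antisymmetric_eq_0) (simp add: cross_triple_swap[of "y (Suc (m - _)) p"])
    finally show ?thesis .
  qed simp
  ultimately have "ds (y n) p \<bullet> y 0 p = 0" by simp
  then show ?case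
    using y_0_unit[OF less.prems]
    unfolding y_Suc[OF smooth_on_y less.prems, of n]
    by (simp add: Cross3.left_diff_distrib cross_mult_left cross_cross_left inner_commute)
qed

end

section \<open>Evolution of the generating loop\<close>

locale curve_evolution = immersed_curves +
  fixes k :: nat
  assumes evolves: "\<And>t x. t \<in> I \<Longrightarrow> ((\<lambda>s. \<gamma> s x) has_vector_derivative Y (\<gamma> t) k x) (at t)"
begin

lemma dt_curve: "p \<in> S \<Longrightarrow> dt \<Gamma> p = y k p"
  using has_vector_derivative_dt[OF smooth, of "fst p" "snd p"] evolves[of "fst p" "snd p"]
  by (auto simp: y_def intro: vector_derivative_unique_at)

text \<open>The flow preserves arclength, since \<open>ds (y k) = y (k + 1) \<times> y 0\<close> has no tangential part.\<close>

lemma dt_inverse_speed: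
  assumes "p \<in> S"
  shows "dt (\<lambda>q. inverse (norm (dx \<Gamma> q))) p = 0"
proof -
  have "dt (dx \<Gamma>) p = dx (y k) p"
    using mixed_partials_commute[OF open_S smooth assms] dx_cong[OF open_S assms dt_curve] by simp
  then have "dt (dx \<Gamma>) p = norm (dx \<Gamma> p) *\<^sub>R (y (Suc k) p \<times> y 0 p)"
    using dx_curve(2)[OF assms] by (simp add: ds_def flip: ds_y[OF assms])
  moreover have "dx \<Gamma> p = norm (dx \<Gamma> p) *\<^sub>R y 0 p"
    using dx_curve(2)[OF assms] by (simp add: y_0[OF assms] ds_def)
  ultimately obtain b c where "dt (dx \<Gamma>) p = b *\<^sub>R (y (Suc k) p \<times> y 0 p)" "dx \<Gamma> p = c *\<^sub>R y 0 p"
    by blast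
  then have orth: "dx \<Gamma> p \<bullet> dt (dx \<Gamma>) p = 0"
    by (simp add: dot_cross_self)
  have "(dx \<Gamma> has_derivative frechet_derivative (dx \<Gamma>) (at p)) (at p)"
    by (rule smooth_on_derivative(1)[OF smooth_on_dx[OF smooth] assms])
  from has_derivative_compose[OF this has_derivative_norm[OF dx_curve(2)[OF assms]]]
  have "((\<lambda>q. norm (dx \<Gamma> q)) has_derivative
      (\<lambda>v. frechet_derivative (dx \<Gamma>) (at p) v \<bullet> sgn (dx \<Gamma> p))) (at p)"
    by simp
  from Deriv.has_derivative_inverse[OF _ this] dx_curve(2)[OF assms]
  have "((\<lambda>q. inverse (norm (dx \<Gamma> q))) has_derivative
      (\<lambda>v. - (inverse (norm (dx \<Gamma> p)) * (frechet_derivative (dx \<Gamma>) (at p) v \<bullet> sgn (dx \<Gamma> p))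
        * inverse (norm (dx \<Gamma> p))))) (at p)"
    by simp
  from frechet_derivative_at[OF this, symmetric] show ?thesis
    using orth by (simp add: dt_def sgn_div_norm inner_commute)
qed

lemma dt_ds_commute:
  fixes F :: "real \<times> real \<Rightarrow> 'b::banach"
  assumes "smooth_on S F" "p \<in> S"
  shows "dt (ds F) p = ds (dt F) p"
  unfolding ds_def[abs_def]
  by (simp add: dt_bilinear[OF bounded_bilinear_scaleR smooth_on_inverse_speed smooth_on_dx]
      assms dt_inverse_speed mixed_partials_commute[OF open_S assms])

text \<open>Induction on \<open>n\<close>. The normal part of \<open>dt (y (n + 1))\<close> comes from differentiating
  \<open>ds (y n) = y (n + 1) \<times> y 0\<close> in \<open>t\<close> and commuting \<open>dt\<close> with \<open>ds\<close>; by
  \<open>V_coeff_product_rule\<close> the claimed values satisfy the same equation. The tangential part comes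
  from differentiating \<open>(Y, Y) = 1\<close>, an equation that the claimed values satisfy by
  \<open>V_coeff_orthogonal\<close>.\<close>

lemma dt_y: "p \<in> S \<Longrightarrow> dt (y n) p = V_coeff k (\<lambda>j. y j p) n"
proof (induction n arbitrary: p rule: less_induct)
  case (less m)
  note p = less.prems
  have base: "dt (y 0) p = V_coeff k (\<lambda>j. y j p) 0" if p: "p \<in> S" for p
  proof -
    have "dt (y 0) p = dt (ds \<Gamma>) p"
      by (rule dt_cong[OF open_S p y_0])
    also have "\<dots> = ds (dt \<Gamma>) p"
      by (rule dt_ds_commute[OF smooth p])
    also have "\<dots> = ds (y k) p"
      by (rule ds_cong[OF p dt_curve])
    finally show ?thesis by (simp add: ds_y[OF p] V_coeff_0)
  qed
  show ?case
  proof (cases m)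
    case 0
    then show ?thesis using base[OF p] by simp
  next
    case (Suc n)
    let ?w = "V_coeff k (\<lambda>j. y j p)"
    have IH: "dt (y n) q = V_coeff k (\<lambda>j. y j q) n" if "q \<in> S" for q
      using less.IH[of n q] that Suc by simp
    have "?w (Suc n) \<times> y 0 p + y (Suc n) p \<times> ?w 0 = ds (\<lambda>q. V_coeff k (\<lambda>j. y j q) n) p"
      unfolding V_coeff_product_rule[of "\<lambda>i. ds (y i) p" "\<lambda>i. y i p", OF ds_y[OF p], symmetric]
      unfolding V_coeff_def
      by (simp add: ds_sum p smooth_on_bilinear[OF bounded_bilinear_cross3 open_S] smooth_on_y
          ds_bilinear[OF bounded_bilinear_cross3 smooth_on_y smooth_on_y])
    also have "\<dots> = ds (dt (y n)) p"
      by (rule ds_cong[OF p IH[symmetric]])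
    also have "\<dots> = dt (ds (y n)) p"
      by (rule dt_ds_commute[OF smooth_on_y p, symmetric])
    also have "\<dots> = dt (\<lambda>q. y (Suc n) q \<times> y 0 q) p"
      by (rule dt_cong[OF open_S p ds_y])
    also have "\<dots> = dt (y (Suc n)) p \<times> y 0 p + y (Suc n) p \<times> ?w 0"
      by (simp add: dt_bilinear[OF bounded_bilinear_cross3 smooth_on_y smooth_on_y p] base[OF p])
    finally have cross: "dt (y (Suc n)) p \<times> y 0 p = ?w (Suc n) \<times> y 0 p"
      by simp

    have "0 = dt (\<lambda>q. \<Sum>i\<le>m. y i q \<bullet> y (m - i) q) p"
      using dt_cong[OF open_S p convolution_y[of _ m]] by (simp add: dt_def)
    also have "\<dots> = (\<Sum>i\<le>m. y i p \<bullet> dt (y (m - i)) p + dt (y i) p \<bullet> y (m - i) p)"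
      by (simp add: dt_sum[OF smooth_on_convolution p]
          dt_bilinear[OF bounded_bilinear_inner smooth_on_y smooth_on_y p])
    also have "\<dots> = 2 * (\<Sum>i\<le>m. dt (y i) p \<bullet> y (m - i) p)"
      by (rule sum_product_rule_convolution)
    finally have "(\<Sum>i<m. dt (y i) p \<bullet> y (m - i) p) + dt (y m) p \<bullet> y 0 p = 0"
      by (simp flip: lessThan_Suc_atMost)
    moreover have "(\<Sum>i<m. dt (y i) p \<bullet> y (m - i) p) = (\<Sum>i<m. ?w i \<bullet> y (m - i) p)"
      by (simp add: less.IH p)
    moreover have "(\<Sum>i<m. ?w i \<bullet> y (m - i) p) + ?w m \<bullet> y 0 p = 0"
      using V_coeff_orthogonal[of k "\<lambda>j. y j p" m] by (simp flip: lessThan_Suc_atMost)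
    ultimately have "dt (y m) p \<bullet> y 0 p = ?w m \<bullet> y 0 p" by simp
    with cross show ?thesis
      using eq_if_cross_and_inner_eq y_0_unit[OF p] Suc by blast
  qed
qed

end

section \<open>The coefficients of the vector fields\<close>

text \<open>The condition \<open>y 0 \<noteq> 0\<close> makes the subdegrees of the two factors \<open>0\<close> and \<open>- (k + 1)\<close>.
  At negative \<open>n\<close> (positive powers of \<open>\<lambda>\<close>) every pair of indices with sum \<open>n + k + 1\<close> occurs,
  because the polynomial factor contains all \<open>y\<^sub>j\<close> with \<open>j \<le> k\<close>, and the sum vanishes by
  antisymmetry.\<close>

lemma V_nth:
  fixes y :: "nat \<Rightarrow> real^3"
  assumes "y 0 \<noteq> 0"
  shows "fls_nth (V k (fps_to_fls (Abs_fps y))) n = (if n < 0 then 0 else V_coeff k y (nat n))"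
proof -
  let ?\<xi> = "fps_to_fls (Abs_fps y)"
  define \<eta> where "\<eta> = loop_plus (fls_shift (int (k + 1)) ?\<xi>)"
  \<comment> \<open>The sum of the indices of \<open>y\<close> in each term: multiplication by \<open>\<lambda>\<^sup>k\<^sup>+\<^sup>1\<close> shifts the
    exponents of the second factor.\<close>
  define N where "N = n + int k + 1"
  have \<eta>_nth: "fls_nth \<eta> m = (if m < 0 \<and> m \<ge> - int (k + 1) then y (nat (m + int (k + 1))) else 0)" for m
    by (auto simp: \<eta>_def loop_plus_nth)
  have sub\<xi>: "fls_subdegree ?\<xi> = 0"
    by (rule fls_subdegree_eqI) (use assms in auto)
  have sub\<eta>: "fls_subdegree \<eta> = - int (k + 1)"
    by (rule fls_subdegree_eqI) (use assms in \<open>auto simp: \<eta>_nth\<close>)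
  have V: "fls_nth (V k ?\<xi>) n
      = (\<Sum>i=0..N. if n < i then y (nat i) \<times> y (nat (N - i)) else 0)"
    unfolding V_def loop_cross_nth \<eta>_def[symmetric] sub\<xi> sub\<eta>
    by (rule sum.cong) (auto simp: \<eta>_nth N_def algebra_simps)
  show ?thesis
  proof (cases "n < 0")
    case True
    have "(\<Sum>i=0..N. y (nat i) \<times> y (nat (N - i))) = 0"
    proof (cases "N < 0")
      case False
      have "(\<Sum>i=0..N. y (nat i) \<times> y (nat (N - i))) = (\<Sum>i\<le>nat N. y (nat N - i) \<times> y i)"
        using False
        by (intro sum.reindex_bij_witness[of _ "\<lambda>i. N - int i" "\<lambda>i. nat (N - i)"])
          (auto simp: nat_diff_distrib)
      then show ?thesis by (simp add: full_cross_sum_eq_0)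
    qed simp
    moreover have "fls_nth (V k ?\<xi>) n = (\<Sum>i=0..N. y (nat i) \<times> y (nat (N - i)))"
      unfolding V by (rule sum.cong) (use True in auto)
    ultimately show ?thesis using True by simp
  next
    case False
    have "(\<Sum>i=0..N. if n < i then y (nat i) \<times> y (nat (N - i)) else 0)
        = (\<Sum>i\<in>{n<..N}. y (nat i) \<times> y (nat (N - i)))"
      using False by (intro sum.mono_neutral_cong_right) auto
    also have "\<dots> = (\<Sum>i\<le>k. y (nat n + k + 1 - i) \<times> y i)"
      using False
      by (intro sum.reindex_bij_witness[of _ "\<lambda>i. N - int i" "\<lambda>i. nat (N - i)"])
        (auto simp: N_def nat_diff_distrib nat_add_distrib algebra_simps intro!: arg_cong2[where f = cross3] arg_cong[where f = y])
    finally show ?thesis using False V by (simp add: V_coeff_def)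
  qed
qed

unbundle no cross3_syntax

theorem theorem9:
  fixes \<tau> :: "real \<Rightarrow> real" and h :: "real^3 \<Rightarrow> real^3"
    and I :: "real set" and \<gamma> :: "real \<Rightarrow> real \<Rightarrow> real^3" and k :: nat
  assumes "is_translation \<tau>"
    and "orientation_preserving_motion h"
    and "is_interval I" and "open I"
    and "smooth_on (I \<times> UNIV) (\<lambda>(t, x). \<gamma> t x)"
    and "\<And>t. t \<in> I \<Longrightarrow> \<gamma> t \<in> curve_space \<tau> h"
    and "\<And>t x. t \<in> I \<Longrightarrow> ((\<lambda>s. \<gamma> s x) has_vector_derivative Y (\<gamma> t) k x) (at t)"
  shows "\<forall>t\<in>I. \<forall>x. has_loop_derivative (\<lambda>s. generating_loop (\<gamma> s) x)
           (V k (generating_loop (\<gamma> t) x)) t"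
proof (intro ballI allI)
  fix t x assume t: "t \<in> I"
  interpret curve_evolution I \<gamma> k
    using assms(4-7) by unfold_locales (auto simp: curve_space_def immersion_def)
  have p: "(t, x) \<in> S" using t by simp
  have "y 0 (t, x) \<noteq> 0" using y_0_unit[OF p] by auto
  then have nonzero: "Y (\<gamma> t) 0 x \<noteq> 0" by (simp add: y_def)
  have deriv: "((\<lambda>s. Y (\<gamma> s) n x) has_vector_derivative V_coeff k (\<lambda>j. Y (\<gamma> t) j x) n) (at t)" for n
    using has_vector_derivative_dt[OF smooth_on_y p, of n] dt_y[OF p, of n] by (simp add: y_def)
  show "has_loop_derivative (\<lambda>s. generating_loop (\<gamma> s) x) (V k (generating_loop (\<gamma> t) x)) t"
    unfolding has_loop_derivative_def generating_loop_def V_nth[of "\<lambda>j. Y (\<gamma> t) j x", OF nonzero]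
    using deriv by auto
qed

end
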